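(* Let $m\ge1$, $\vec t=(t_1,\dots,t_m)$ with $t_1<\cdots<t_m$ real, and $\omega_0,\dots,\omega_m$ real with $\sum_{k=0}^\ell\omega_k\ge0$ for $\ell=0,\dots,m$, such that $w(x;\vec t)={\rm e}^{-x^2}\big(\omega_0+\sum_{k=1}^m\omega_k\theta(x-t_k)\big)$ is not identically zero. Let $n\ge1$ and $R_{n,k}$ be as in the context. Then, for $k=1,\dots,m$, wherever $R_{n,k}\neq0$, $$\mathcal L^2R_{n,k}-\frac{(\mathcal LR_{n,k})^2}{2R_{n,k}}=R_{n,k}\Bigg[\frac32\Big(\sum_{j=1}^mR_{n,j}\Big)^2-2\sum_{j=1}^m(t_k+t_j)R_{n,j}+2(t_k^2-2n-1)\Bigg],$$ where $\mathcal L=\sum_{k=1}^m\partial/\partial t_k$ and $\mathcal L^2=\mathcal L\circ\mathcal L=\sum_{k=1}^m\frac{\partial^2}{\partial t_k^2}+2\sum_{j<k}\frac{\partial^2}{\partial t_k\partial t_j}$.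
   Context: $\theta(y)=1$ for $y>0$ and $0$ otherwise. $P_n(z;\vec t)$ is the monic degree-$n$ polynomial orthogonal w.r.t. $w(\cdot;\vec t)$ on $\mathbb{R}$, $\int P_jP_kw\,dx=h_k\delta_{jk}$, $h_k>0$. For $k=1,\dots,m$: $R_{n,k}(\vec t):=\omega_k{\rm e}^{-t_k^2}P_n(t_k;\vec t)^2/h_n(\vec t)$. *)

theory Defs
  imports "HOL-Analysis.Analysis" "HOL-Computational_Algebra.Polynomial"
begin

definition theta :: "real \<Rightarrow> real" where
  "theta y = (if y > 0 then 1 else 0)"

definition wgt :: "nat \<Rightarrow> (nat \<Rightarrow> real) \<Rightarrow> (nat \<Rightarrow> real) \<Rightarrow> real \<Rightarrow> real" where
  "wgt m \<omega> t x = exp (- x\<^sup>2) * (\<omega> 0 + (\<Sum>k=1..m. \<omega> k * theta (x - t k)))"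

definition orth_poly :: "nat \<Rightarrow> (nat \<Rightarrow> real) \<Rightarrow> (nat \<Rightarrow> real) \<Rightarrow> nat \<Rightarrow> real poly" where
  "orth_poly m \<omega> t n = (THE p. degree p = n \<and> lead_coeff p = 1 \<and>
     (\<forall>q. degree q < n \<longrightarrow>
        integral\<^sup>L lborel (\<lambda>x. poly p x * poly q x * wgt m \<omega> t x) = 0))"

definition hnorm :: "nat \<Rightarrow> (nat \<Rightarrow> real) \<Rightarrow> (nat \<Rightarrow> real) \<Rightarrow> nat \<Rightarrow> real" where
  "hnorm m \<omega> t n = integral\<^sup>L lborel (\<lambda>x. (poly (orth_poly m \<omega> t n) x)\<^sup>2 * wgt m \<omega> t x)"

definition Rnk :: "nat \<Rightarrow> (nat \<Rightarrow> real) \<Rightarrow> nat \<Rightarrow> nat \<Rightarrow> (nat \<Rightarrow> real) \<Rightarrow> real" where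
  "Rnk m \<omega> n k t = \<omega> k * exp (- (t k)\<^sup>2) * (poly (orth_poly m \<omega> t n) (t k))\<^sup>2 / hnorm m \<omega> t n"

definition partial_t :: "nat \<Rightarrow> ((nat \<Rightarrow> real) \<Rightarrow> real) \<Rightarrow> (nat \<Rightarrow> real) \<Rightarrow> real" where
  "partial_t k f t = deriv (\<lambda>s. f (t(k := s))) (t k)"

definition Lop :: "nat \<Rightarrow> ((nat \<Rightarrow> real) \<Rightarrow> real) \<Rightarrow> (nat \<Rightarrow> real) \<Rightarrow> real" where
  "Lop m f t = (\<Sum>k=1..m. partial_t k f t)"

end

theory Submission
  imports Defs "HOL-Probability.Distributions" "HOL-Real_Asymp.Real_Asymp"
begin

text \<open>
Let \<open>\<alpha>\<^sub>n\<close>, \<open>\<beta>\<^sub>n\<close> be the coefficients of the three-term recurrence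
\<open>x P\<^sub>n = P\<^sub>n\<^sub>+\<^sub>1 + \<alpha>\<^sub>n P\<^sub>n + \<beta>\<^sub>n P\<^sub>n\<^sub>-\<^sub>1\<close>. The operator \<open>L\<close> differentiates along a
simultaneous translation of all jumps. Substituting \<open>x + s\<close> for \<open>x\<close> turns that translation into
the factor \<open>exp (- 2 s x - s\<^sup>2)\<close> on the weight, so \<open>L\<close> acts as a Toda flow:
\<open>L P\<^sub>n = 2 \<beta>\<^sub>n P\<^sub>n\<^sub>-\<^sub>1 - P\<^sub>n'\<close>, \<open>L h\<^sub>n = - 2 \<alpha>\<^sub>n h\<^sub>n\<close>,
\<open>L \<alpha>\<^sub>n = 1 + 2 \<beta>\<^sub>n - 2 \<beta>\<^sub>n\<^sub>+\<^sub>1\<close>, \<open>L \<beta>\<^sub>n = 2 \<beta>\<^sub>n (\<alpha>\<^sub>n\<^sub>-\<^sub>1 - \<alpha>\<^sub>n)\<close>.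
With \<open>r\<^sub>k = \<omega>\<^sub>k exp (- t\<^sub>k\<^sup>2) P\<^sub>n(t\<^sub>k) P\<^sub>n\<^sub>-\<^sub>1(t\<^sub>k) / h\<^sub>n\<^sub>-\<^sub>1\<close> this gives
\<open>L R\<^sub>k = (2 \<alpha>\<^sub>n - 2 t\<^sub>k) R\<^sub>k + 4 r\<^sub>k\<close> and \<open>R\<^sub>k L r\<^sub>k = 2 r\<^sub>k\<^sup>2 - 2 \<beta>\<^sub>n R\<^sub>k\<^sup>2\<close>. Integrating the
derivatives of \<open>P\<^sub>n\<^sup>2 w\<close> and \<open>x P\<^sub>n\<^sup>2 w\<close> over the line yields \<open>2 \<alpha>\<^sub>n = \<Sum>\<^sub>j R\<^sub>j\<close> and
\<open>2 (\<alpha>\<^sub>n\<^sup>2 + \<beta>\<^sub>n + \<beta>\<^sub>n\<^sub>+\<^sub>1) = 2 n + 1 + \<Sum>\<^sub>j t\<^sub>j R\<^sub>j\<close>, which eliminates the recurrence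
coefficients from \<open>L\<^sup>2 R\<^sub>k\<close>.
\<close>

subsection \<open>Gaussian integrals over half-lines\<close>

definition gauss :: "real poly \<Rightarrow> real \<Rightarrow> real" where
  "gauss p x = poly p x * exp (- x\<^sup>2)"

text \<open>The derivative of a polynomial times \<open>exp (- x\<^sup>2)\<close> has the same
  shape; this is its polynomial factor, so integration by parts becomes an operation on
  polynomials.\<close>

definition gauss_deriv :: "real poly \<Rightarrow> real poly" where
  "gauss_deriv p = pderiv p - [:0, 2:] * p"

lemma continuous_gauss: "isCont (gauss p) x"
  unfolding gauss_def by (intro continuous_intros) 

lemma measurable_gauss [measurable]: "gauss p \<in> borel_measurable borel"
  by (intro borel_measurable_continuous_onI continuous_at_imp_continuous_on ballI continuous_gauss)

lemma measurable_theta [measurable]: "theta \<in> borel_measurable borel"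
  unfolding theta_def by measurable

lemma gauss_has_deriv: "(gauss p has_real_derivative gauss (gauss_deriv p) x) (at x)"
  unfolding gauss_def gauss_deriv_def
  by (auto intro!: derivative_eq_intros simp: algebra_simps)

text \<open>Up to the factor \<open>sqrt pi\<close>, \<open>exp (- x\<^sup>2)\<close> is the centred
  normal density of variance 1/2, all of whose moments exist.\<close>

lemma integrable_power_gauss: "integrable lborel (\<lambda>x::real. x ^ i * exp (- x\<^sup>2))"
proof -
  have "integrable lborel (\<lambda>x. sqrt pi * (normal_density 0 (sqrt (1/2)) x * (x - 0) ^ i))"
    by (intro integrable_mult_right integrable_normal_moment) auto
  moreover have "(\<lambda>x. sqrt pi * (normal_density 0 (sqrt (1/2)) x * (x - 0) ^ i)) = (\<lambda>x. x ^ i * exp (- x\<^sup>2))"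
    by (auto simp: normal_density_def fun_eq_iff)
  ultimately show ?thesis by (simp only:)
qed

lemma integrable_gauss: "integrable lborel (gauss p)"
proof -
  have "gauss p = (\<lambda>x. \<Sum>i\<le>degree p. coeff p i * (x ^ i * exp (- x\<^sup>2)))"
    by (auto simp: gauss_def poly_altdef sum_distrib_right fun_eq_iff mult.assoc)
  then show ?thesis
    by (auto intro!: Bochner_Integration.integrable_sum integrable_power_gauss)
qed

lemma integrable_gauss_theta: "integrable lborel (\<lambda>x. gauss p x * theta (x - a))"
  by (rule Bochner_Integration.integrable_bound[OF integrable_gauss[of p]])
     (auto simp: theta_def)

lemma gauss_limits: "(gauss p \<longlongrightarrow> 0) at_top" "(gauss p \<longlongrightarrow> 0) at_bot"
proof -
  have *: "gauss p = (\<lambda>x. \<Sum>i\<le>degree p. coeff p i * (x ^ i * exp (- x\<^sup>2)))"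
    by (auto simp: gauss_def poly_altdef sum_distrib_right fun_eq_iff mult.assoc)
  have "((\<lambda>x::real. x ^ i * exp (- x\<^sup>2)) \<longlongrightarrow> 0) at_top" for i
    by real_asymp
  then show "(gauss p \<longlongrightarrow> 0) at_top"
    unfolding * by (auto intro!: tendsto_null_sum tendsto_mult_right_zero)
  have "((\<lambda>x::real. x ^ i * exp (- x\<^sup>2)) \<longlongrightarrow> 0) at_bot" for i
    by real_asymp
  then show "(gauss p \<longlongrightarrow> 0) at_bot"
    unfolding * by (auto intro!: tendsto_null_sum tendsto_mult_right_zero)
qed

definition gauss_tail :: "real poly \<Rightarrow> real \<Rightarrow> real" where
  "gauss_tail p a = (\<integral>x. gauss p x * theta (x - a) \<partial>lborel)"

text \<open>Fundamental theorem of calculus on the half-line; Gaussian decay removes the boundary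
  term at infinity.\<close>

lemma gauss_tail_deriv: "gauss_tail (gauss_deriv p) a = - gauss p a"
proof -
  have "(LBINT x=ereal a..\<infinity>. gauss (gauss_deriv p) x) = 0 - gauss p a"
  proof (rule interval_integral_FTC_integrable)
    show "(gauss p has_vector_derivative gauss (gauss_deriv p) x) (at x)" for x
      using gauss_has_deriv has_real_derivative_iff_has_vector_derivative by blast
    show "set_integrable lborel (einterval (ereal a) \<infinity>) (gauss (gauss_deriv p))"
      unfolding set_integrable_def
      by (rule Bochner_Integration.integrable_bound[OF integrable_gauss[of "gauss_deriv p"]])
         (auto simp: indicator_def)
    have "(gauss p \<longlongrightarrow> gauss p a) (at_right a)"
      using continuous_gauss[of a p] 
      by (metis continuous_at_imp_continuous_at_within continuous_within)
    then show "((gauss p \<circ> real_of_ereal) \<longlongrightarrow> gauss p a) (at_right (ereal a))"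
      by (simp add: ereal_tendsto_simps)
    show "((gauss p \<circ> real_of_ereal) \<longlongrightarrow> 0) (at_left \<infinity>)"
      using gauss_limits[of p] by (simp add: ereal_tendsto_simps)
  qed (auto simp: continuous_gauss)
  moreover have "(LBINT x=ereal a..\<infinity>. gauss (gauss_deriv p) x) = gauss_tail (gauss_deriv p) a"
    unfolding gauss_tail_def interval_lebesgue_integral_def set_lebesgue_integral_def
    by (auto intro!: Bochner_Integration.integral_cong simp: theta_def indicator_def einterval_def)
  ultimately show ?thesis by simp
qed

lemma integral_gauss_deriv: "(\<integral>x. gauss (gauss_deriv p) x \<partial>lborel) = 0"
proof -
  have "(LBINT x=-\<infinity>..\<infinity>. gauss (gauss_deriv p) x) = 0 - 0"
  proof (rule interval_integral_FTC_integrable)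
    show "(gauss p has_vector_derivative gauss (gauss_deriv p) x) (at x)" for x
      using gauss_has_deriv has_real_derivative_iff_has_vector_derivative by blast
    show "set_integrable lborel (einterval (-\<infinity>) \<infinity>) (gauss (gauss_deriv p))"
      unfolding set_integrable_def
      by (rule Bochner_Integration.integrable_bound[OF integrable_gauss[of "gauss_deriv p"]])
         (auto simp: indicator_def)
    show "((gauss p \<circ> real_of_ereal) \<longlongrightarrow> 0) (at_left \<infinity>)" "((gauss p \<circ> real_of_ereal) \<longlongrightarrow> 0) (at_right (-\<infinity>))"
      using gauss_limits[of p] by (simp_all add: ereal_tendsto_simps)
  qed (auto simp: continuous_gauss)
  moreover have "(LBINT x=-\<infinity>..\<infinity>. gauss (gauss_deriv p) x) = (\<integral>x. gauss (gauss_deriv p) x \<partial>lborel)"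
    unfolding interval_lebesgue_integral_def set_lebesgue_integral_def
    by (auto intro!: Bochner_Integration.integral_cong simp: theta_def indicator_def einterval_def)
  ultimately show ?thesis by simp
qed

text \<open>Near \<open>a\<close> the tail is a fixed tail minus a proper integral with variable
  upper limit.\<close>

lemma gauss_tail_has_deriv: "(gauss_tail p has_real_derivative - gauss p a) (at a)"
proof -
  define c b where "c = a - 1" and "b = a + 1"
  have cont: "continuous_on S (gauss p)" for S
    by (intro continuous_at_imp_continuous_on ballI continuous_gauss)
  have tail: "gauss_tail p x = gauss_tail p c - integral {c..x} (gauss p)" if "c \<le> x" for x
  proof -
    have int: "set_integrable lborel {c..x} (gauss p)"
      unfolding set_integrable_def
      by (rule Bochner_Integration.integrable_bound[OF integrable_gauss[of p]])
         (auto simp: indicator_def)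
    have "integral {c..x} (gauss p) = (LINT y:{c..x}|lborel. gauss p y)"
      using set_borel_integral_eq_integral(2)[OF int] by simp
    also have "\<dots> = (\<integral>y. gauss p y * theta (y - c) - gauss p y * theta (y - x) \<partial>lborel)"
      unfolding set_lebesgue_integral_def
    proof (rule integral_cong_AE)
      \<comment> \<open>The two sides differ only at \<open>y = c\<close>, where
        \<open>theta (y - c)\<close> is 0.\<close>
      show "AE y in lborel. indicat_real {c..x} y *\<^sub>R gauss p y =
              gauss p y * theta (y - c) - gauss p y * theta (y - x)"
        using AE_lborel_singleton[of c]
        by eventually_elim (use that in \<open>auto simp: theta_def indicator_def\<close>)
    qed measurable
    also have "\<dots> = gauss_tail p c - gauss_tail p x"
      unfolding gauss_tail_def by (intro Bochner_Integration.integral_diff integrable_gauss_theta)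
    finally show ?thesis by simp
  qed
  have "((\<lambda>x. integral {c..x} (gauss p)) has_real_derivative gauss p a) (at a within {c..b})"
    by (rule integral_has_real_derivative) (auto simp: cont c_def b_def)
  then have "((\<lambda>x. integral {c..x} (gauss p)) has_real_derivative gauss p a) (at a)"
    by (subst (asm) at_within_interior) (auto simp: c_def b_def interior_atLeastAtMost_real)
  then have "((\<lambda>x. gauss_tail p c - integral {c..x} (gauss p)) has_real_derivative - gauss p a) (at a)"
    by (auto intro!: derivative_eq_intros)
  moreover have "\<forall>\<^sub>F x in nhds a. gauss_tail p c - integral {c..x} (gauss p) = gauss_tail p x"
  proof (rule eventually_mono)
    show "\<forall>\<^sub>F x in nhds a. x \<in> {c<..}"
      by (rule eventually_nhds_in_open) (auto simp: c_def)
  qed (metis tail greaterThan_iff less_imp_le)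
  ultimately show ?thesis
    by (rule DERIV_cong_ev[OF refl _ refl, THEN iffD1, rotated])
qed

subsection \<open>The derivation L\<close>

text \<open>
\<open>has_L m f d t\<close>: the function \<open>f\<close> has a gradient at \<open>t\<close> that computes its derivative along every
curve through \<open>t\<close> with differentiable coordinates, and \<open>L f = d\<close>. Testing along curves makes the
chain rule available without a norm on \<open>nat \<Rightarrow> real\<close>.
\<close>

definition has_L :: "nat \<Rightarrow> ((nat \<Rightarrow> real) \<Rightarrow> real) \<Rightarrow> real \<Rightarrow> (nat \<Rightarrow> real) \<Rightarrow> bool" where
  "has_L m f d t \<longleftrightarrow> (\<exists>g. (\<forall>\<gamma> v. \<gamma> 0 = t \<longrightarrow>
       (\<forall>k. ((\<lambda>s. \<gamma> s k) has_real_derivative v k) (at 0)) \<longrightarrow>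
       ((\<lambda>s. f (\<gamma> s)) has_real_derivative (\<Sum>k=1..m. g k * v k)) (at 0))
     \<and> (\<Sum>k=1..m. g k) = d)"

lemma has_L_I:
  assumes "\<And>\<gamma> v. \<gamma> 0 = t \<Longrightarrow> (\<And>k. ((\<lambda>s. \<gamma> s k) has_real_derivative v k) (at 0)) \<Longrightarrow>
       ((\<lambda>s. f (\<gamma> s)) has_real_derivative (\<Sum>k=1..m. g k * v k)) (at 0)"
    and "(\<Sum>k=1..m. g k) = d"
  shows "has_L m f d t"
  unfolding has_L_def using assms by blast

lemma has_L_E:
  assumes "has_L m f d t"
  obtains g where "\<And>\<gamma> v. \<gamma> 0 = t \<Longrightarrow> (\<And>k. ((\<lambda>s. \<gamma> s k) has_real_derivative v k) (at 0)) \<Longrightarrow>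
       ((\<lambda>s. f (\<gamma> s)) has_real_derivative (\<Sum>k=1..m. g k * v k)) (at 0)"
    and "(\<Sum>k=1..m. g k) = d"
  using assms unfolding has_L_def by blast

lemma has_L_imp_Lop:
  assumes "has_L m f d t"
  shows "Lop m f t = d"
proof -
  obtain g where g: "\<And>\<gamma> v. \<gamma> 0 = t \<Longrightarrow> (\<And>k. ((\<lambda>s. \<gamma> s k) has_real_derivative v k) (at 0)) \<Longrightarrow>
       ((\<lambda>s. f (\<gamma> s)) has_real_derivative (\<Sum>k=1..m. g k * v k)) (at 0)"
    and d: "(\<Sum>k=1..m. g k) = d"
    using has_L_E[OF assms] by blast
  have "partial_t k f t = g k" if k: "k \<in> {1..m}" for k
  proof -
    have "((\<lambda>s. f (t(k := s + t k))) has_real_derivative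
            (\<Sum>j=1..m. g j * (if j = k then 1 else 0))) (at 0)"
      by (rule g) (auto intro!: derivative_eq_intros)
    also have "(\<Sum>j=1..m. g j * (if j = k then 1 else 0)) = g k"
      using k by (subst sum.remove[of _ k]) auto
    finally have "((\<lambda>s. f (t(k := s))) has_real_derivative g k) (at (0 + t k))"
      by (simp only: DERIV_shift)
    then show ?thesis
      unfolding partial_t_def by (intro DERIV_imp_deriv) simp
  qed
  then show ?thesis
    unfolding Lop_def d[symmetric] by (intro sum.cong) auto
qed

lemma has_L_unique: "has_L m f d t \<Longrightarrow> has_L m f d' t \<Longrightarrow> d = d'"
  using has_L_imp_Lop by blast

lemma has_L_const: "has_L m (\<lambda>_. c) 0 t"
  by (rule has_L_I[where g = "\<lambda>_. 0"]) auto

lemma has_L_coord: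
  assumes "1 \<le> k" "k \<le> m" and \<phi>: "(\<phi> has_real_derivative D) (at (t k))"
  shows "has_L m (\<lambda>t. \<phi> (t k)) D t"
proof (rule has_L_I[where g = "\<lambda>j. if j = k then D else 0"])
  fix \<gamma> v assume \<gamma>: "\<gamma> (0::real) = t" "\<And>k. ((\<lambda>s. \<gamma> s k) has_real_derivative v k) (at 0)"
  have "((\<lambda>s. \<phi> (\<gamma> s k)) has_real_derivative D * v k) (at 0)"
    using \<phi> \<gamma> by (intro DERIV_chain2[of \<phi>]) auto
  also have "D * v k = (\<Sum>j=1..m. (if j = k then D else 0) * v j)"
    using assms by (subst sum.remove[of _ k]) auto
  finally show "((\<lambda>s. \<phi> (\<gamma> s k)) has_real_derivative \<dots>) (at 0)" .
qed (use assms in \<open>auto simp: sum.remove[of _ k]\<close>)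

lemma has_L_add:
  assumes "has_L m f d t" "has_L m f' d' t"
  shows "has_L m (\<lambda>t. f t + f' t) (d + d') t"
proof -
  obtain g where g: "\<And>\<gamma> v. \<gamma> 0 = t \<Longrightarrow> (\<And>k. ((\<lambda>s. \<gamma> s k) has_real_derivative v k) (at 0)) \<Longrightarrow>
       ((\<lambda>s. f (\<gamma> s)) has_real_derivative (\<Sum>k=1..m. g k * v k)) (at 0)"
    and d: "(\<Sum>k=1..m. g k) = d"
    using has_L_E[OF assms(1)] by blast
  obtain g' where g': "\<And>\<gamma> v. \<gamma> 0 = t \<Longrightarrow> (\<And>k. ((\<lambda>s. \<gamma> s k) has_real_derivative v k) (at 0)) \<Longrightarrow>
       ((\<lambda>s. f' (\<gamma> s)) has_real_derivative (\<Sum>k=1..m. g' k * v k)) (at 0)"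
    and d': "(\<Sum>k=1..m. g' k) = d'"
    using has_L_E[OF assms(2)] by blast
  show ?thesis
  proof (rule has_L_I[where g = "\<lambda>k. g k + g' k"])
    fix \<gamma> v assume *: "\<gamma> (0::real) = t" "\<And>k. ((\<lambda>s. \<gamma> s k) has_real_derivative v k) (at 0)"
    show "((\<lambda>s. f (\<gamma> s) + f' (\<gamma> s)) has_real_derivative (\<Sum>k=1..m. (g k + g' k) * v k)) (at 0)"
      by (rule DERIV_cong[OF DERIV_add[OF g[OF *] g'[OF *]]])
         (auto simp: algebra_simps sum.distrib)
  qed (simp only: sum.distrib d d')
qed

lemma has_L_mult:
  assumes "has_L m f d t" "has_L m f' d' t"
  shows "has_L m (\<lambda>t. f t * f' t) (d * f' t + f t * d') t"
proof -
  obtain g where g: "\<And>\<gamma> v. \<gamma> 0 = t \<Longrightarrow> (\<And>k. ((\<lambda>s. \<gamma> s k) has_real_derivative v k) (at 0)) \<Longrightarrow>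
       ((\<lambda>s. f (\<gamma> s)) has_real_derivative (\<Sum>k=1..m. g k * v k)) (at 0)"
    and d: "(\<Sum>k=1..m. g k) = d"
    using has_L_E[OF assms(1)] by blast
  obtain g' where g': "\<And>\<gamma> v. \<gamma> 0 = t \<Longrightarrow> (\<And>k. ((\<lambda>s. \<gamma> s k) has_real_derivative v k) (at 0)) \<Longrightarrow>
       ((\<lambda>s. f' (\<gamma> s)) has_real_derivative (\<Sum>k=1..m. g' k * v k)) (at 0)"
    and d': "(\<Sum>k=1..m. g' k) = d'"
    using has_L_E[OF assms(2)] by blast
  show ?thesis
  proof (rule has_L_I[where g = "\<lambda>k. g k * f' t + f t * g' k"])
    fix \<gamma> v assume *: "\<gamma> (0::real) = t" "\<And>k. ((\<lambda>s. \<gamma> s k) has_real_derivative v k) (at 0)"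
    show "((\<lambda>s. f (\<gamma> s) * f' (\<gamma> s)) has_real_derivative
             (\<Sum>k=1..m. (g k * f' t + f t * g' k) * v k)) (at 0)"
      by (rule DERIV_cong[OF DERIV_mult[OF g[OF *] g'[OF *]]])
         (auto simp: algebra_simps sum.distrib sum_distrib_left sum_distrib_right *)
  qed (auto simp: sum.distrib d[symmetric] d'[symmetric] sum_distrib_left sum_distrib_right)
qed

lemma has_L_inverse:
  assumes "has_L m f d t" "f t \<noteq> 0"
  shows "has_L m (\<lambda>t. inverse (f t)) (- (d / (f t)\<^sup>2)) t"
proof -
  obtain g where g: "\<And>\<gamma> v. \<gamma> 0 = t \<Longrightarrow> (\<And>k. ((\<lambda>s. \<gamma> s k) has_real_derivative v k) (at 0)) \<Longrightarrow>
       ((\<lambda>s. f (\<gamma> s)) has_real_derivative (\<Sum>k=1..m. g k * v k)) (at 0)"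
    and d: "(\<Sum>k=1..m. g k) = d"
    using has_L_E[OF assms(1)] by blast
  show ?thesis
  proof (rule has_L_I[where g = "\<lambda>k. - (g k / (f t)\<^sup>2)"])
    fix \<gamma> v assume *: "\<gamma> (0::real) = t" "\<And>k. ((\<lambda>s. \<gamma> s k) has_real_derivative v k) (at 0)"
    show "((\<lambda>s. inverse (f (\<gamma> s))) has_real_derivative (\<Sum>k=1..m. - (g k / (f t)\<^sup>2) * v k)) (at 0)"
      by (rule DERIV_cong[OF DERIV_inverse_fun[OF g[OF *]]])
         (auto simp: * assms(2) sum_negf sum_distrib_left sum_distrib_right power2_eq_square
            divide_inverse mult_ac)
  qed (auto simp: sum_negf d[symmetric] sum_divide_distrib)
qed

lemma has_L_minus: "has_L m f d t \<Longrightarrow> has_L m (\<lambda>t. - f t) (- d) t"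
  using has_L_mult[OF has_L_const[of m "-1"]] by fastforce

lemma has_L_diff:
  "has_L m f d t \<Longrightarrow> has_L m f' d' t \<Longrightarrow> has_L m (\<lambda>t. f t - f' t) (d - d') t"
  using has_L_add[OF _ has_L_minus] by fastforce

lemma has_L_divide:
  assumes "has_L m f d t" "has_L m f' d' t" "f' t \<noteq> 0"
  shows "has_L m (\<lambda>t. f t / f' t) ((d - f t / f' t * d') / f' t) t"
proof -
  have "has_L m (\<lambda>t. f t * inverse (f' t)) (d * inverse (f' t) + f t * - (d' / (f' t)\<^sup>2)) t"
    by (intro has_L_mult has_L_inverse assms)
  moreover have "d * inverse (f' t) + f t * - (d' / (f' t)\<^sup>2) = (d - f t / f' t * d') / f' t"
    using assms(3) by (simp add: field_simps power2_eq_square)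
  ultimately show ?thesis
    by (simp add: divide_inverse)
qed

lemma has_L_sum:
  "(\<And>i. i \<in> A \<Longrightarrow> has_L m (f i) (d i) t) \<Longrightarrow> has_L m (\<lambda>t. \<Sum>i\<in>A. f i t) (\<Sum>i\<in>A. d i) t"
  by (induction A rule: infinite_finite_induct) (auto intro: has_L_const has_L_add)

definition ordered :: "nat \<Rightarrow> (nat \<Rightarrow> real) \<Rightarrow> bool" where
  "ordered m t \<longleftrightarrow> (\<forall>i j. 1 \<le> i \<longrightarrow> i < j \<longrightarrow> j \<le> m \<longrightarrow> t i < t j)"

text \<open>Finitely many strict inequalities persist along a curve near \<open>t\<close>, so values
  at unordered tuples do not affect the derivative. This matters because \<open>orth_poly\<close> is
  identified with explicit polynomials only at ordered tuples.\<close>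

lemma has_L_transfer:
  assumes f: "has_L m f d t" and t: "ordered m t" and eq: "\<And>t. ordered m t \<Longrightarrow> f t = f' t"
  shows "has_L m f' d t"
proof -
  obtain g where g: "\<And>\<gamma> v. \<gamma> 0 = t \<Longrightarrow> (\<And>k. ((\<lambda>s. \<gamma> s k) has_real_derivative v k) (at 0)) \<Longrightarrow>
       ((\<lambda>s. f (\<gamma> s)) has_real_derivative (\<Sum>k=1..m. g k * v k)) (at 0)"
    and d: "(\<Sum>k=1..m. g k) = d"
    using has_L_E[OF f] by blast
  show ?thesis
  proof (rule has_L_I[OF _ d])
    fix \<gamma> v assume *: "\<gamma> (0::real) = t" "\<And>k. ((\<lambda>s. \<gamma> s k) has_real_derivative v k) (at 0)"
    have cont: "((\<lambda>s. \<gamma> s k) \<longlongrightarrow> \<gamma> 0 k) (nhds 0)" for k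
      using DERIV_isCont[OF *(2)[of k]] unfolding isCont_def
      by (rule tendsto_at_iff_tendsto_nhds[of "\<lambda>s. \<gamma> s k", THEN iffD1])
    have "\<forall>\<^sub>F s in nhds 0. \<forall>i\<in>{1..m}. \<forall>j\<in>{i<..m}. \<gamma> s i < \<gamma> s j"
    proof (intro eventually_ball_finite ballI finite_atLeastAtMost finite_greaterThanAtMost)
      fix i j assume "i \<in> {1..m}" "j \<in> {i<..m}"
      then have "0 < \<gamma> 0 j - \<gamma> 0 i"
        using t * unfolding ordered_def by auto
      from order_tendstoD(1)[OF tendsto_diff[OF cont cont] this]
      show "\<forall>\<^sub>F s in nhds 0. \<gamma> s i < \<gamma> s j"
        by (rule eventually_mono) simp
    qed
    then have "\<forall>\<^sub>F s in nhds 0. f (\<gamma> s) = f' (\<gamma> s)"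
      by (rule eventually_mono) (auto intro!: eq simp: ordered_def)
    with g[OF *] show "((\<lambda>s. f' (\<gamma> s)) has_real_derivative (\<Sum>k=1..m. g k * v k)) (at 0)"
      by (rule DERIV_cong_ev[OF refl _ refl, THEN iffD1, rotated])
  qed
qed

section \<open>Polynomials whose coefficients depend on the jump points\<close>

text \<open>The degree bound, uniform in \<open>t\<close>, is needed to write \<open>p t\<close> as a sum over a fixed index set.\<close>

definition has_pL :: "nat \<Rightarrow> ((nat \<Rightarrow> real) \<Rightarrow> real poly) \<Rightarrow> real poly \<Rightarrow> (nat \<Rightarrow> real) \<Rightarrow> bool" where
  "has_pL m p d t \<longleftrightarrow>
     (\<forall>i. has_L m (\<lambda>t. coeff (p t) i) (coeff d i) t) \<and> (\<exists>N. \<forall>t. degree (p t) \<le> N)"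

lemma has_pL_coeff: "has_pL m p d t \<Longrightarrow> has_L m (\<lambda>t. coeff (p t) i) (coeff d i) t"
  by (simp add: has_pL_def)

text \<open>A coefficient beyond the uniform bound vanishes identically, so its derivative is 0 by
  uniqueness; the same \<open>N\<close> thus serves for \<open>d\<close>.\<close>

lemma has_pL_degree:
  assumes "has_pL m p d t"
  obtains N where "\<And>t. degree (p t) \<le> N" "degree d \<le> N"
proof -
  obtain N where N: "\<And>t. degree (p t) \<le> N"
    using assms by (auto simp: has_pL_def)
  have "coeff d i = 0" if "i > N" for i
  proof -
    have "has_L m (\<lambda>t. coeff (p t) i) (coeff d i) t"
      by (rule has_pL_coeff[OF assms])
    moreover have "coeff (p t) i = 0" for t
      using le_less_trans[OF N that] by (rule coeff_eq_0)
    ultimately have "has_L m (\<lambda>t. 0) (coeff d i) t"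
      by (simp only:)
    then show ?thesis
      by (rule has_L_unique[OF _ has_L_const])
  qed
  then have "degree d \<le> N"
    by (intro degree_le) blast
  with N show ?thesis
    by (rule that)
qed

lemma has_pL_const: "has_pL m (\<lambda>_. p) 0 t"
  by (auto simp: has_pL_def intro: has_L_const)

lemma has_pL_add:
  assumes "has_pL m p d t" "has_pL m q e t"
  shows "has_pL m (\<lambda>t. p t + q t) (d + e) t"
proof -
  obtain N where N: "\<And>t. degree (p t) \<le> N" using has_pL_degree[OF assms(1)] by blast
  obtain M where M: "\<And>t. degree (q t) \<le> M" using has_pL_degree[OF assms(2)] by blast
  have "degree (p t + q t) \<le> max N M" for t
    using N M by (intro degree_add_le) (auto simp: le_max_iff_disj)
  moreover have "has_L m (\<lambda>t. coeff (p t + q t) i) (coeff (d + e) i) t" for i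
    unfolding coeff_add by (intro has_L_add has_pL_coeff assms)
  ultimately show ?thesis
    unfolding has_pL_def by blast
qed

lemma has_pL_mult:
  assumes "has_pL m p d t" "has_pL m q e t"
  shows "has_pL m (\<lambda>t. p t * q t) (d * q t + p t * e) t"
proof -
  obtain N where N: "\<And>t. degree (p t) \<le> N" using has_pL_degree[OF assms(1)] by blast
  obtain M where M: "\<And>t. degree (q t) \<le> M" using has_pL_degree[OF assms(2)] by blast
  have "degree (p t * q t) \<le> N + M" for t
    using N M by (meson add_mono degree_mult_le order_trans)
  moreover have "has_L m (\<lambda>t. coeff (p t * q t) i) (coeff (d * q t + p t * e) i) t" for i
    unfolding coeff_mult coeff_add sum.distrib[symmetric]
    by (intro has_L_sum has_L_mult has_pL_coeff assms)
  ultimately show ?thesis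
    unfolding has_pL_def by blast
qed

lemma has_pL_scalar:
  assumes "has_L m f d t"
  shows "has_pL m (\<lambda>t. [:f t:]) [:d:] t"
  using assms unfolding has_pL_def
  by (auto intro!: exI[of _ 0] has_L_const simp: coeff_pCons split: nat.splits)

lemma has_pL_smult:
  assumes "has_L m f d t" "has_pL m q e t"
  shows "has_pL m (\<lambda>t. smult (f t) (q t)) (smult d (q t) + smult (f t) e) t"
  using has_pL_mult[OF has_pL_scalar[OF assms(1)] assms(2)] by simp

lemma has_pL_diff:
  assumes "has_pL m p d t" "has_pL m q e t"
  shows "has_pL m (\<lambda>t. p t - q t) (d - e) t"
  using has_pL_add[OF assms(1) has_pL_smult[OF has_L_const[of m "-1"] assms(2)]] by simp

lemma poly_eq_sum_le:
  fixes p :: "'a::comm_semiring_1 poly"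
  assumes "degree p \<le> N"
  shows "poly p x = (\<Sum>i\<le>N. coeff p i * x ^ i)"
  unfolding poly_altdef using assms
  by (intro sum.mono_neutral_left) (auto simp: coeff_eq_0)

text \<open>Coefficients and evaluation point both move; since \<open>L t\<^sub>k = 1\<close>, the
  second motion contributes the ordinary derivative.\<close>

lemma has_L_poly_eval:
  assumes p: "has_pL m p d t" and k: "1 \<le> k" "k \<le> m"
  shows "has_L m (\<lambda>t. poly (p t) (t k)) (poly d (t k) + poly (pderiv (p t)) (t k)) t"
proof -
  obtain N where N: "\<And>t. degree (p t) \<le> N" "degree d \<le> N"
    using has_pL_degree[OF p] by blast
  have "has_L m (\<lambda>t. \<Sum>i\<le>N. coeff (p t) i * t k ^ i)
          (\<Sum>i\<le>N. coeff d i * t k ^ i + coeff (p t) i * (real i * t k ^ (i - 1))) t"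
    by (intro has_L_sum has_L_mult has_pL_coeff[OF p] has_L_coord[OF k, of "\<lambda>x. x ^ _"])
       (auto intro!: derivative_eq_intros)
  moreover have "poly (pderiv (p t)) x = (\<Sum>i\<le>N. coeff (p t) i * (real i * x ^ (i - 1)))" for x
  proof (rule DERIV_unique)
    show "((\<lambda>x. \<Sum>i\<le>N. coeff (p t) i * x ^ i) has_real_derivative
             (\<Sum>i\<le>N. coeff (p t) i * (real i * x ^ (i - 1)))) (at x)"
      by (intro DERIV_sum DERIV_cmult) (use DERIV_pow in simp)
    show "((\<lambda>x. \<Sum>i\<le>N. coeff (p t) i * x ^ i) has_real_derivative poly (pderiv (p t)) x) (at x)"
      unfolding poly_eq_sum_le[OF N(1), symmetric] by (rule poly_DERIV)
  qed
  ultimately show ?thesis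
    unfolding poly_eq_sum_le[OF N(1)] poly_eq_sum_le[OF N(2)] by (simp only: sum.distrib)
qed

subsection \<open>The moment functional\<close>

text \<open>When exactly the first \<open>l\<close> jumps lie to the left of \<open>x\<close>, the
  step factor is a partial sum. This turns the sign condition on partial sums into one on the
  weight.\<close>

lemma wgt_eq_partial_sum:
  assumes "l \<le> m" "\<And>k. k \<in> {1..m} \<Longrightarrow> t k < x \<longleftrightarrow> k \<le> l"
  shows "wgt m \<omega> t x = exp (- x\<^sup>2) * (\<Sum>k=0..l. \<omega> k)"
proof -
  have "(\<Sum>k=1..m. \<omega> k * theta (x - t k)) = (\<Sum>k=1..m. if k \<le> l then \<omega> k else 0)"
    using assms(2) by (intro sum.cong) (auto simp: theta_def)
  also have "\<dots> = (\<Sum>k=1..l. \<omega> k)"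
    using assms(1) by (intro sum.mono_neutral_cong_right) auto
  finally show ?thesis
    by (simp add: wgt_def sum.atLeast_Suc_atMost[of 0 l])
qed

lemma ordered_less: "ordered m t \<Longrightarrow> 1 \<le> i \<Longrightarrow> i < j \<Longrightarrow> j \<le> m \<Longrightarrow> t i < t j"
  by (auto simp: ordered_def)

lemma ordered_le: "ordered m t \<Longrightarrow> 1 \<le> i \<Longrightarrow> i \<le> j \<Longrightarrow> j \<le> m \<Longrightarrow> t i \<le> t j"
  using ordered_less[of m t i j] by (cases "i = j") auto

lemma ordered_step_index:
  assumes "ordered m t"
  obtains l where "l \<le> m" "\<And>k. k \<in> {1..m} \<Longrightarrow> t k < x \<longleftrightarrow> k \<le> l"
proof -
  \<comment> \<open>Index 0 is a sentinel that keeps the set nonempty; the maximum counts the jumps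
    below \<open>x\<close>.\<close>
  define A where "A = {k. k \<le> m \<and> (k = 0 \<or> t k < x)}"
  have A: "finite A" "A \<noteq> {}" by (auto simp: A_def)
  have "Max A \<in> A" using A by (rule Max_in)
  moreover have "t k < x \<longleftrightarrow> k \<le> Max A" if "k \<in> {1..m}" for k
  proof
    assume "t k < x"
    then show "k \<le> Max A"
      using that A by (intro Max_ge) (auto simp: A_def)
  next
    assume "k \<le> Max A"
    then show "t k < x"
      using that \<open>Max A \<in> A\<close> ordered_le[OF assms, of k "Max A"] by (force simp: A_def)
  qed
  ultimately show ?thesis
    using that by (auto simp: A_def)
qed

text \<open>Counterpart of \<open>ordered_step_index\<close>: the step factor attains every partial
  sum on a whole interval, hence on a set of positive measure.\<close>

lemma ordered_step_interval:
  assumes t: "ordered m t" and "l \<le> m"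
  obtains a b where "a < b" "\<And>x k. x \<in> {a<..<b} \<Longrightarrow> k \<in> {1..m} \<Longrightarrow> t k < x \<longleftrightarrow> k \<le> l"
proof -
  define a where "a = (if l = 0 then t 1 - 1 else t l)"
  define b where "b = (if l = m then a + 1 else t (Suc l))"
  have "a < b"
    using ordered_less[OF t, of l "Suc l"] \<open>l \<le> m\<close> by (auto simp: a_def b_def)
  moreover have "t k < x \<longleftrightarrow> k \<le> l" if "x \<in> {a<..<b}" "k \<in> {1..m}" for x k
  proof
    assume "t k < x"
    show "k \<le> l"
    proof (rule ccontr)
      assume "\<not> k \<le> l"
      then have "t (Suc l) \<le> t k" "l \<noteq> m"
        using that(2) by (auto intro!: ordered_le[OF t])
      then show False
        using that \<open>t k < x\<close> by (auto simp: b_def)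
    qed
  next
    assume "k \<le> l"
    then have "t k \<le> t l" "l \<noteq> 0"
      using that(2) \<open>l \<le> m\<close> by (auto intro!: ordered_le[OF t])
    then show "t k < x"
      using that by (auto simp: a_def)
  qed
  ultimately show ?thesis
    using that by blast
qed

definition moment :: "nat \<Rightarrow> (nat \<Rightarrow> real) \<Rightarrow> (nat \<Rightarrow> real) \<Rightarrow> real poly \<Rightarrow> real" where
  "moment m \<omega> t p = (\<integral>x. poly p x * wgt m \<omega> t x \<partial>lborel)"

lemma poly_mult_wgt:
  "poly p x * wgt m \<omega> t x = \<omega> 0 * gauss p x + (\<Sum>k=1..m. \<omega> k * (gauss p x * theta (x - t k)))"
  by (simp add: wgt_def gauss_def algebra_simps sum_distrib_left)

lemma integrable_poly_wgt: "integrable lborel (\<lambda>x. poly p x * wgt m \<omega> t x)"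
  unfolding poly_mult_wgt
  by (intro Bochner_Integration.integrable_add Bochner_Integration.integrable_sum
      integrable_mult_right integrable_gauss integrable_gauss_theta)

lemma moment_eq:
  "moment m \<omega> t p = \<omega> 0 * (\<integral>x. gauss p x \<partial>lborel) + (\<Sum>k=1..m. \<omega> k * gauss_tail p (t k))"
  unfolding moment_def poly_mult_wgt gauss_tail_def
  by (subst Bochner_Integration.integral_add Bochner_Integration.integral_sum;
      (intro Bochner_Integration.integrable_sum
      integrable_mult_right integrable_gauss integrable_gauss_theta)?)+ simp

lemma moment_add: "moment m \<omega> t (p + q) = moment m \<omega> t p + moment m \<omega> t q"
  unfolding moment_def poly_add distrib_right
  by (intro Bochner_Integration.integral_add integrable_poly_wgt)

lemma moment_smult: "moment m \<omega> t (smult c p) = c * moment m \<omega> t p"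
  by (simp add: moment_def mult.assoc)

lemma moment_0: "moment m \<omega> t 0 = 0"
  by (simp add: moment_def)

lemma moment_diff: "moment m \<omega> t (p - q) = moment m \<omega> t p - moment m \<omega> t q"
  using moment_add[of m \<omega> t p "smult (- 1) q"] by (simp only: moment_smult) simp

lemma moment_sum: "moment m \<omega> t (sum f A) = (\<Sum>i\<in>A. moment m \<omega> t (f i))"
  by (induction A rule: infinite_finite_induct) (simp_all add: moment_0 moment_add)

text \<open>Between jumps the integrand is an exact derivative, so only boundary terms at the
  discontinuities of the weight survive.\<close>

lemma moment_gauss_deriv:
  "moment m \<omega> t (gauss_deriv p) = - (\<Sum>k=1..m. \<omega> k * gauss p (t k))"
  by (simp add: moment_eq integral_gauss_deriv gauss_tail_deriv sum_negf)

lemma moment_eq_sum_coeff: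
  assumes "degree p \<le> N"
  shows "moment m \<omega> t p = (\<Sum>i\<le>N. coeff p i * moment m \<omega> t (monom 1 i))"
proof -
  have "p = (\<Sum>i\<le>N. smult (coeff p i) (monom 1 i))"
    using poly_as_sum_of_monoms'[OF assms] by (simp add: smult_monom)
  then have "moment m \<omega> t p = moment m \<omega> t (\<Sum>i\<le>N. smult (coeff p i) (monom 1 i))"
    by (rule arg_cong)
  then show ?thesis
    by (simp only: moment_sum moment_smult)
qed

lemma gauss_deriv_sum: "gauss_deriv (sum f A) = (\<Sum>i\<in>A. gauss_deriv (f i))"
  by (induction A rule: infinite_finite_induct)
     (simp_all add: gauss_deriv_def pderiv_add algebra_simps)

lemma gauss_deriv_smult: "gauss_deriv (smult c p) = smult c (gauss_deriv p)"
  by (simp add: gauss_deriv_def pderiv_smult smult_diff_right)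

text \<open>Moving \<open>t k\<close> changes its half-line integral at rate
  \<open>- gauss p (t k)\<close>; weighted by \<open>\<omega> k\<close> and summed, these are the
  boundary terms of \<open>moment_gauss_deriv\<close>. Translating the jumps thus amounts to
  differentiating the integrand.\<close>

lemma has_L_moment_const: "has_L m (\<lambda>t. moment m \<omega> t p) (moment m \<omega> t (gauss_deriv p)) t"
proof -
  have "has_L m (\<lambda>t. \<omega> 0 * (\<integral>x. gauss p x \<partial>lborel) + (\<Sum>k=1..m. \<omega> k * gauss_tail p (t k)))
     (0 + (\<Sum>k=1..m. 0 * gauss_tail p (t k) + \<omega> k * - gauss p (t k))) t"
    by (intro has_L_add has_L_const has_L_sum has_L_mult has_L_coord gauss_tail_has_deriv) auto
  moreover have "0 + (\<Sum>k=1..m. 0 * gauss_tail p (t k) + \<omega> k * - gauss p (t k))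
      = moment m \<omega> t (gauss_deriv p)"
    by (simp add: moment_gauss_deriv sum_negf)
  ultimately show ?thesis
    unfolding moment_eq by (simp only:)
qed

lemma has_L_moment:
  assumes p: "has_pL m p d t"
  shows "has_L m (\<lambda>t. moment m \<omega> t (p t)) (moment m \<omega> t (d + gauss_deriv (p t))) t"
proof -
  obtain N where N: "\<And>t. degree (p t) \<le> N" "degree d \<le> N"
    using has_pL_degree[OF p] by blast
  have "p t = (\<Sum>i\<le>N. smult (coeff (p t) i) (monom 1 i))"
    using poly_as_sum_of_monoms'[OF N(1)[of t]] by (simp add: smult_monom)
  then have "gauss_deriv (p t) = gauss_deriv (\<Sum>i\<le>N. smult (coeff (p t) i) (monom 1 i))"
    by (rule arg_cong)
  then have *: "moment m \<omega> t (gauss_deriv (p t)) =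
      (\<Sum>i\<le>N. coeff (p t) i * moment m \<omega> t (gauss_deriv (monom 1 i)))"
    by (simp only: gauss_deriv_sum gauss_deriv_smult moment_sum moment_smult)
  have "has_L m (\<lambda>t. \<Sum>i\<le>N. coeff (p t) i * moment m \<omega> t (monom 1 i))
     (\<Sum>i\<le>N. coeff d i * moment m \<omega> t (monom 1 i)
         + coeff (p t) i * moment m \<omega> t (gauss_deriv (monom 1 i))) t"
    by (intro has_L_sum has_L_mult has_pL_coeff[OF p] has_L_moment_const)
  then show ?thesis
    unfolding moment_eq_sum_coeff[OF N(1)] moment_add * moment_eq_sum_coeff[OF N(2)]
    by (simp only: sum.distrib)
qed

text \<open>Nonvanishing of the weight is expressed through partial sums so that the assumptions do
  not mention \<open>t\<close> and stay available while the jumps move.\<close>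

locale jump_weight =
  fixes m :: nat and \<omega> :: "nat \<Rightarrow> real"
  assumes partial_sums_nonneg: "\<And>l. l \<le> m \<Longrightarrow> (\<Sum>k=0..l. \<omega> k) \<ge> 0"
    and partial_sums_nonzero: "\<exists>l\<le>m. (\<Sum>k=0..l. \<omega> k) \<noteq> 0"
begin

abbreviation E :: "(nat \<Rightarrow> real) \<Rightarrow> real poly \<Rightarrow> real" where
  "E \<equiv> moment m \<omega>"

lemma wgt_nonneg:
  assumes "ordered m t"
  shows "wgt m \<omega> t x \<ge> 0"
proof -
  obtain l where "l \<le> m" "\<And>k. k \<in> {1..m} \<Longrightarrow> t k < x \<longleftrightarrow> k \<le> l"
    using ordered_step_index[OF assms] by blast
  then show ?thesis
    using partial_sums_nonneg wgt_eq_partial_sum[of l m t x \<omega>] by simp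
qed

text \<open>The integrand is nonnegative, and on some interval where the weight is nonzero it
  vanishes only at the finitely many roots of \<open>p\<close>.\<close>

lemma E_square_pos:
  assumes t: "ordered m t" and p: "p \<noteq> 0"
  shows "E t (p * p) > 0"
proof -
  have nonneg: "0 \<le> poly (p * p) x * wgt m \<omega> t x" for x
    using wgt_nonneg[OF t] by simp
  have "E t (p * p) \<noteq> 0"
  proof
    assume "E t (p * p) = 0"
    then have AE: "AE x in lborel. poly (p * p) x * wgt m \<omega> t x = 0"
      unfolding moment_def
      using integral_nonneg_eq_0_iff_AE[OF integrable_poly_wgt AE_I2, OF nonneg] by blast
    obtain l where l: "l \<le> m" "(\<Sum>k=0..l. \<omega> k) \<noteq> 0"
      using partial_sums_nonzero by blast
    obtain a b where ab: "a < b" "\<And>x k. x \<in> {a<..<b} \<Longrightarrow> k \<in> {1..m} \<Longrightarrow> t k < x \<longleftrightarrow> k \<le> l"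
      using ordered_step_interval[OF t l(1)] by blast
    have w: "wgt m \<omega> t x \<noteq> 0" if "x \<in> {a<..<b}" for x
      using wgt_eq_partial_sum[OF l(1) ab(2)[OF that]] l(2) by simp
    have "finite {x. poly p x = 0}"
      using p by (rule poly_roots_finite)
    then have "AE x in lborel. x \<notin> {x. poly p x = 0}"
      by (intro AE_not_in finite_imp_null_set_lborel)
    with AE have "AE x in lborel. x \<notin> {a<..<b}"
      by eventually_elim (use w in auto)
    then have "{a<..<b} \<in> null_sets lborel"
      by (subst (asm) AE_iff_null_sets[symmetric]) auto
    then show False
      using ab(1) by (simp add: null_sets_def)
  qed
  moreover have "E t (p * p) \<ge> 0"
    unfolding moment_def using nonneg by (intro Bochner_Integration.integral_nonneg) auto
  ultimately show ?thesis by simp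
qed

subsection \<open>Orthogonal polynomials\<close>

text \<open>Building the orthogonal polynomials by their recurrence, not by a description, makes
  differentiation in \<open>t\<close> possible by induction. The coefficients are the later
  \<open>\<alpha>\<close> and \<open>\<beta>\<close>, written out because those refer to
  \<open>P\<close>.\<close>

fun P :: "(nat \<Rightarrow> real) \<Rightarrow> nat \<Rightarrow> real poly" where
  "P t 0 = 1"
| "P t (Suc 0) = [:- (E t [:0, 1:] / E t 1), 1:]"
| "P t (Suc (Suc n)) =
     [:- (E t ([:0, 1:] * P t (Suc n) * P t (Suc n)) / E t (P t (Suc n) * P t (Suc n))), 1:] * P t (Suc n)
     - smult (E t (P t (Suc n) * P t (Suc n)) / E t (P t n * P t n)) (P t n)"

definition h :: "(nat \<Rightarrow> real) \<Rightarrow> nat \<Rightarrow> real" where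
  "h t n = E t (P t n * P t n)"

definition \<alpha> :: "(nat \<Rightarrow> real) \<Rightarrow> nat \<Rightarrow> real" where
  "\<alpha> t n = E t ([:0, 1:] * P t n * P t n) / h t n"

text \<open>The value 0 at \<open>n = 0\<close> keeps the recurrence uniform: it cancels the term
  with \<open>P t (n - 1)\<close>, which truncated subtraction turns into
  \<open>P t 0\<close>.\<close>

definition \<beta> :: "(nat \<Rightarrow> real) \<Rightarrow> nat \<Rightarrow> real" where
  "\<beta> t n = (if n = 0 then 0 else h t n / h t (n - 1))"

lemma \<beta>_0 [simp]: "\<beta> t 0 = 0"
  by (simp add: \<beta>_def)

lemma P_Suc: "P t (Suc n) = [:- \<alpha> t n, 1:] * P t n - smult (\<beta> t n) (P t (n - 1))"
  by (cases n) (simp_all add: \<alpha>_def \<beta>_def h_def)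

declare P.simps(2,3) [simp del]

lemma X_mult_P: "[:0, 1:] * P t n = P t (Suc n) + smult (\<alpha> t n) (P t n) + smult (\<beta> t n) (P t (n - 1))"
  unfolding P_Suc by simp

lemma P_monic: "degree (P t n) = n \<and> coeff (P t n) n = 1"
proof (induction n rule: less_induct)
  case (less n)
  show ?case
  proof (cases n)
    case (Suc i)
    have i: "degree (P t i) = i" "coeff (P t i) i = 1" and "degree (P t (i - 1)) \<le> i"
      using less[of i] less[of "i - 1"] Suc by auto
    have 1: "coeff (P t (Suc i)) (Suc i) = 1"
      using i \<open>degree (P t (i - 1)) \<le> i\<close> unfolding P_Suc by (auto simp: coeff_eq_0)
    have "degree (P t (Suc i)) \<le> Suc i"
      unfolding P_Suc
    proof (rule degree_diff_le)
      show "degree ([:- \<alpha> t i, 1:] * P t i) \<le> Suc i"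
        using degree_mult_le[of "[:- \<alpha> t i, 1:]" "P t i"] i by simp
      show "degree (smult (\<beta> t i) (P t (i - 1))) \<le> Suc i"
        using \<open>degree (P t (i - 1)) \<le> i\<close> degree_smult_le[of "\<beta> t i" "P t (i - 1)"] by linarith
    qed
    moreover have "Suc i \<le> degree (P t (Suc i))"
      using 1 by (intro le_degree) simp
    ultimately show ?thesis
      using 1 Suc by simp
  qed simp
qed

lemma degree_P [simp]: "degree (P t n) = n" and coeff_P [simp]: "coeff (P t n) n = 1"
  using P_monic by auto

lemma P_nonzero [simp]: "P t n \<noteq> 0"
  using coeff_P[of t n] by force

lemma h_pos: "ordered m t \<Longrightarrow> h t n > 0"
  unfolding h_def by (rule E_square_pos) simp_all

lemma degree_monic_remainder:
  assumes "degree q \<le> Suc n"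
  shows "degree (q - smult (coeff q (Suc n)) (P t (Suc n))) \<le> n"
proof (rule degree_le, intro allI impI)
  fix i assume "i > n"
  then consider "i = Suc n" | "i > Suc n" by linarith
  then show "coeff (q - smult (coeff q (Suc n)) (P t (Suc n))) i = 0"
    using assms by cases (auto simp: coeff_eq_0)
qed

text \<open>Orthogonality and normalization in one formula. The recurrence moves a factor
  \<open>x\<close> from \<open>P\<close> onto the other polynomial, so that lower indices
  apply.\<close>

lemma E_P_mult:
  assumes t: "ordered m t"
  shows "degree q \<le> n \<Longrightarrow> E t (P t n * q) = coeff q n * h t n"
proof (induction n arbitrary: q rule: less_induct)
  case (less n)
  note h_nz = h_pos[OF t, THEN less_imp_neq, symmetric]
  show ?case
  proof (cases n)
    case 0
    then obtain c where "q = [:c:]"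
      using less.prems degree_eq_zeroE by blast
    then show ?thesis
      using 0 moment_smult[of m \<omega> t c 1] by (simp add: h_def)
  next
    case (Suc i)
    have rec: "E t (P t (Suc i) * r) =
        E t (P t i * ([:0, 1:] * r)) - \<alpha> t i * E t (P t i * r) - \<beta> t i * E t (P t (i - 1) * r)" for r
    proof -
      have "P t (Suc i) * r = P t i * ([:0, 1:] * r) - smult (\<alpha> t i) (P t i * r)
              - smult (\<beta> t i) (P t (i - 1) * r)"
        unfolding P_Suc by (simp add: algebra_simps)
      then show ?thesis
        by (simp only: moment_diff moment_smult)
    qed
    have IH: "E t (P t i * r) = coeff r i * h t i" if "degree r \<le> i" for r
      using less.IH[of i r] that Suc by simp
    have IH': "E t (P t (i - 1) * r) = coeff r (i - 1) * h t (i - 1)" if "degree r \<le> i - 1" for r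
      using less.IH[of "i - 1" r] that Suc by simp
    \<comment> \<open>Here the choice of \<open>\<alpha>\<close> produces the cancellation.\<close>
    have top: "E t (P t (Suc i) * P t i) = 0"
    proof -
      have "\<beta> t i * E t (P t (i - 1) * P t i) = 0"
        using IH[of "P t (i - 1)"] by (cases i) (auto simp: mult.commute coeff_eq_0)
      moreover have "E t (P t i * ([:0, 1:] * P t i)) = \<alpha> t i * h t i"
        using h_nz[of i] by (simp add: \<alpha>_def mult_ac)
      ultimately show ?thesis
        unfolding rec by (simp add: h_def)
    qed
    have lower: "E t (P t (Suc i) * r) = 0" if "degree r \<le> i" for r
    proof (cases i)
      case 0
      with that obtain c where "r = [:c:]"
        using degree_eq_zeroE[of r] by auto
      then have "r = smult c (P t i)"
        using 0 by simp
      then show ?thesis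
        using top by (simp add: moment_smult)
    next
      case (Suc j)
      define r' where "r' = r - smult (coeff r (Suc j)) (P t (Suc j))"
      have r': "degree r' \<le> j"
        unfolding r'_def using that Suc by (intro degree_monic_remainder) simp
      \<comment> \<open>Here the choice of \<open>\<beta>\<close> does:
        \<open>coeff r' j * h t i\<close> cancels against
        \<open>\<beta> t i * (coeff r' j * h t j)\<close>.\<close>
      have "E t (P t (Suc i) * r') = 0"
      proof -
        have "degree ([:0, 1:] * r') \<le> i"
          using degree_mult_le[of "[:0, 1:]" r'] r' Suc by simp
        then have "E t (P t i * ([:0, 1:] * r')) = coeff r' j * h t i"
          by (subst IH) (simp_all add: Suc)
        moreover have "E t (P t i * r') = 0"
          using r' Suc by (subst IH) (auto simp: coeff_eq_0)
        moreover have "E t (P t (i - 1) * r') = coeff r' j * h t j"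
          using r' Suc by (subst IH') auto
        ultimately show ?thesis
          unfolding rec using h_nz[of j] by (simp add: \<beta>_def Suc)
      qed
      moreover have "P t (Suc i) * r = P t (Suc i) * r' + smult (coeff r (Suc j)) (P t (Suc i) * P t i)"
        by (simp add: r'_def Suc algebra_simps)
      ultimately show ?thesis
        using top by (simp add: moment_add moment_smult)
    qed
    define r where "r = q - smult (coeff q (Suc i)) (P t (Suc i))"
    have "degree r \<le> i"
      unfolding r_def using less.prems Suc by (intro degree_monic_remainder) simp
    moreover have "P t (Suc i) * q = P t (Suc i) * r + smult (coeff q (Suc i)) (P t (Suc i) * P t (Suc i))"
      by (simp add: r_def algebra_simps)
    ultimately show ?thesis
      using lower[of r] unfolding Suc by (simp add: moment_add moment_smult h_def)
  qed
qed

text \<open>Two candidates differ by a polynomial of degree below \<open>n\<close>, to which both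
  are orthogonal; so the difference is orthogonal to itself and vanishes by positivity.\<close>

lemma orth_poly_eq_P:
  assumes t: "ordered m t"
  shows "orth_poly m \<omega> t n = P t n"
  unfolding orth_poly_def
proof (rule the_equality)
  have "E t (P t n * q) = 0" if "degree q < n" for q
    using that by (simp add: E_P_mult[OF t] coeff_eq_0)
  then show *: "degree (P t n) = n \<and> lead_coeff (P t n) = 1 \<and>
     (\<forall>q. degree q < n \<longrightarrow> (\<integral>x. poly (P t n) x * poly q x * wgt m \<omega> t x \<partial>lborel) = 0)"
    by (simp add: moment_def)
  fix p
  assume p: "degree p = n \<and> lead_coeff p = 1 \<and>
     (\<forall>q. degree q < n \<longrightarrow> (\<integral>x. poly p x * poly q x * wgt m \<omega> t x \<partial>lborel) = 0)"
  define d where "d = p - P t n"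
  have "d = 0"
  proof (rule ccontr)
    assume "d \<noteq> 0"
    have "degree d \<le> n"
      unfolding d_def using p by (intro degree_diff_le) auto
    moreover have "coeff d n = 0"
      using p by (auto simp: d_def)
    ultimately have "degree d < n"
      using \<open>d \<noteq> 0\<close> by (metis leading_coeff_0_iff le_neq_implies_less)
    with p * have "E t (p * d) = 0" "E t (P t n * d) = 0"
      by (auto simp: moment_def)
    then have "E t (d * d) = 0"
      unfolding d_def by (simp only: left_diff_distrib moment_diff)
    with E_square_pos[OF t \<open>d \<noteq> 0\<close>] show False
      by simp
  qed
  then show "p = P t n"
    by (simp add: d_def)
qed

lemma hnorm_eq_h: "ordered m t \<Longrightarrow> hnorm m \<omega> t n = h t n"
  by (simp add: hnorm_def orth_poly_eq_P h_def moment_def power2_eq_square)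

lemma E_P_prev:
  assumes "ordered m t" "n \<noteq> 0"
  shows "E t (P t n * P t (n - 1)) = 0"
  using assms by (simp add: E_P_mult coeff_eq_0)

lemma E_X_P_P:
  assumes "ordered m t"
  shows "E t ([:0, 1:] * P t n * P t n) = \<alpha> t n * h t n"
  using h_pos[OF assms, of n] by (simp add: \<alpha>_def)

text \<open>The factor \<open>\<beta> t n\<close> absorbs the case \<open>n = 0\<close>, where
  \<open>P t (n - 1)\<close> is \<open>P t n\<close> itself and the moment is positive.\<close>

lemma \<beta>_mult_E_P_prev: "ordered m t \<Longrightarrow> \<beta> t n * E t (P t n * P t (n - 1)) = 0"
  using E_P_prev[of t n] by (cases "n = 0") auto

lemma \<beta>_mult_E_X_P_prev:
  assumes "ordered m t"
  shows "\<beta> t n * E t ([:0, 1:] * P t n * P t (n - 1)) = \<beta> t n * h t n"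
proof (cases n)
  case (Suc i)
  have "E t (P t n * ([:0, 1:] * P t i)) = h t n"
    by (subst E_P_mult[OF assms]) (simp_all add: Suc)
  then show ?thesis
    by (simp add: Suc mult_ac)
qed simp

text \<open>Expanding one factor \<open>x P\<^sub>n\<close> by the recurrence leaves three known
  moments.\<close>

lemma E_X_P_X_P:
  assumes t: "ordered m t"
  shows "E t ([:0, 1:] * P t n * ([:0, 1:] * P t n)) =
     h t n * (\<beta> t (Suc n) + (\<alpha> t n)\<^sup>2 + \<beta> t n)"
proof -
  have 1: "E t (P t (Suc n) * ([:0, 1:] * P t n)) = h t (Suc n)"
    by (subst E_P_mult[OF t]) simp_all
  have "[:0, 1:] * P t n * ([:0, 1:] * P t n) = P t (Suc n) * ([:0, 1:] * P t n)
      + smult (\<alpha> t n) ([:0, 1:] * P t n * P t n) + smult (\<beta> t n) ([:0, 1:] * P t n * P t (n - 1))"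
    by (subst X_mult_P[of t n]) (simp add: algebra_simps)
  then have "E t ([:0, 1:] * P t n * ([:0, 1:] * P t n)) =
      h t (Suc n) + \<alpha> t n * (\<alpha> t n * h t n) + \<beta> t n * h t n"
    by (simp only: moment_add moment_smult 1 E_X_P_P[OF t] \<beta>_mult_E_X_P_prev[OF t])
  also have "h t (Suc n) = \<beta> t (Suc n) * h t n"
    using h_pos[OF t, of n] by (simp add: \<beta>_def)
  finally show ?thesis
    by (simp add: algebra_simps power2_eq_square)
qed

subsection \<open>The Toda flow\<close>

text \<open>The value of \<open>L P\<^sub>n\<close>, with \<open>x\<close> held fixed.\<close>

definition dP :: "(nat \<Rightarrow> real) \<Rightarrow> nat \<Rightarrow> real poly" where
  "dP t n = smult (2 * \<beta> t n) (P t (n - 1)) - pderiv (P t n)"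

text \<open>The terms with \<open>pderiv\<close> cancel, orthogonality removes
  \<open>P\<^sub>n P\<^sub>n\<^sub>-\<^sub>1\<close>, and \<open>- 2 x P\<^sub>n\<^sup>2\<close>
  remains. The formula for \<open>L P\<^sub>n\<close> is assumed here and in the next two lemmas
  because its inductive proof relies on them.\<close>

lemma has_L_h:
  assumes t: "ordered m t" and P: "has_pL m (\<lambda>t. P t n) (dP t n) t"
  shows "has_L m (\<lambda>t. h t n) (- 2 * \<alpha> t n * h t n) t"
proof -
  have "has_L m (\<lambda>t. h t n)
     (E t (dP t n * P t n + P t n * dP t n + gauss_deriv (P t n * P t n))) t"
    unfolding h_def by (rule has_L_moment[OF has_pL_mult[OF P P]])
  moreover have "dP t n * P t n + P t n * dP t n + gauss_deriv (P t n * P t n) =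
      smult 4 (smult (\<beta> t n) (P t n * P t (n - 1))) - smult 2 ([:0, 1:] * P t n * P t n)"
    by (simp add: dP_def gauss_deriv_def pderiv_mult algebra_simps flip: smult_add_left)
  then have "E t (dP t n * P t n + P t n * dP t n + gauss_deriv (P t n * P t n))
      = - 2 * \<alpha> t n * h t n"
    by (simp only: moment_diff moment_smult \<beta>_mult_E_P_prev[OF t] E_X_P_P[OF t])
  ultimately show ?thesis
    by (simp only:)
qed

text \<open>The summand 1 comes from differentiating the factor \<open>x\<close>; in the quotient
  rule the squares of \<open>\<alpha>\<close> cancel against \<open>L h\<^sub>n\<close>.\<close>

lemma has_L_\<alpha>:
  assumes t: "ordered m t" and P: "has_pL m (\<lambda>t. P t n) (dP t n) t"
  shows "has_L m (\<lambda>t. \<alpha> t n) (1 + 2 * \<beta> t n - 2 * \<beta> t (Suc n)) t"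
proof -
  note h_nz = h_pos[OF t, THEN less_imp_neq, symmetric]
  let ?d = "[:0, 1:] * (dP t n * P t n + P t n * dP t n) + gauss_deriv ([:0, 1:] * P t n * P t n)"
  have "has_pL m (\<lambda>t. [:0, 1:] * (P t n * P t n))
     (0 * (P t n * P t n) + [:0, 1:] * (dP t n * P t n + P t n * dP t n)) t"
    by (rule has_pL_mult[OF has_pL_const has_pL_mult[OF P P]])
  then have "has_pL m (\<lambda>t. [:0, 1:] * P t n * P t n)
     ([:0, 1:] * (dP t n * P t n + P t n * dP t n)) t"
    by (simp add: mult.assoc)
  then have "has_L m (\<lambda>t. E t ([:0, 1:] * P t n * P t n)) (E t ?d) t"
    by (rule has_L_moment)
  moreover have "?d = P t n * P t n + smult 4 (smult (\<beta> t n) ([:0, 1:] * P t n * P t (n - 1)))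
      - smult 2 ([:0, 1:] * P t n * ([:0, 1:] * P t n))"
    by (simp add: dP_def gauss_deriv_def pderiv_mult pderiv_pCons algebra_simps flip: smult_add_left)
  then have Ed: "E t ?d = h t n * (1 + 2 * \<beta> t n - 2 * \<beta> t (Suc n) - 2 * (\<alpha> t n)\<^sup>2)"
    by (simp only: moment_add moment_diff moment_smult \<beta>_mult_E_X_P_prev[OF t] E_X_P_X_P[OF t])
       (simp add: h_def algebra_simps)
  ultimately have "has_L m (\<lambda>t. \<alpha> t n)
     ((h t n * (1 + 2 * \<beta> t n - 2 * \<beta> t (Suc n) - 2 * (\<alpha> t n)\<^sup>2) - \<alpha> t n * (- 2 * \<alpha> t n * h t n)) / h t n) t"
    unfolding \<alpha>_def by (intro has_L_divide has_L_h[OF t P, unfolded \<alpha>_def] h_nz) (simp only: \<alpha>_def)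
  moreover have "(h t n * (1 + 2 * \<beta> t n - 2 * \<beta> t (Suc n) - 2 * (\<alpha> t n)\<^sup>2)
        - \<alpha> t n * (- 2 * \<alpha> t n * h t n)) / h t n = 1 + 2 * \<beta> t n - 2 * \<beta> t (Suc n)"
    using h_nz[of n] by (simp add: field_simps power2_eq_square)
  ultimately show ?thesis
    by (simp only:)
qed

lemma has_L_\<beta>:
  assumes t: "ordered m t" and "has_pL m (\<lambda>t. P t n) (dP t n) t"
    "has_pL m (\<lambda>t. P t (n - 1)) (dP t (n - 1)) t"
  shows "has_L m (\<lambda>t. \<beta> t n) (2 * \<beta> t n * (\<alpha> t (n - 1) - \<alpha> t n)) t"
proof (cases n)
  case 0
  then show ?thesis
    by (simp add: has_L_const)
next
  case (Suc i)
  note h_nz = h_pos[OF t, THEN less_imp_neq, symmetric]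
  have "has_L m (\<lambda>t. h t n / h t (n - 1)) ((- 2 * \<alpha> t n * h t n
      - h t n / h t (n - 1) * (- 2 * \<alpha> t (n - 1) * h t (n - 1))) / h t (n - 1)) t"
    by (intro has_L_divide has_L_h assms h_nz)
  moreover have "(- 2 * \<alpha> t n * h t n
      - h t n / h t (n - 1) * (- 2 * \<alpha> t (n - 1) * h t (n - 1))) / h t (n - 1)
      = 2 * \<beta> t n * (\<alpha> t (n - 1) - \<alpha> t n)"
    using h_nz[of "n - 1"] Suc by (simp add: field_simps \<beta>_def)
  ultimately have "has_L m (\<lambda>t. h t n / h t (n - 1)) (2 * \<beta> t n * (\<alpha> t (n - 1) - \<alpha> t n)) t"
    by (simp only:)
  then show ?thesis
    using Suc by (simp add: \<beta>_def)
qed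

lemma has_pL_P:
  assumes t: "ordered m t"
  shows "has_pL m (\<lambda>t. P t n) (dP t n) t"
proof (induction n rule: less_induct)
  case (less n)
  show ?case
  proof (cases n)
    case 0
    then show ?thesis
      using has_pL_const[of m 1 t] by (simp add: dP_def)
  next
    case (Suc i)
    have i: "has_pL m (\<lambda>t. P t i) (dP t i) t" "has_pL m (\<lambda>t. P t (i - 1)) (dP t (i - 1)) t"
      using less Suc by auto
    define a where "a = 1 + 2 * \<beta> t i - 2 * \<beta> t (Suc i)"
    define b where "b = 2 * \<beta> t i * (\<alpha> t (i - 1) - \<alpha> t i)"
    have "has_pL m (\<lambda>t. ([:0, 1:] - [:\<alpha> t i:]) * P t i - smult (\<beta> t i) (P t (i - 1)))
       ((0 - [:a:]) * P t i + ([:0, 1:] - [:\<alpha> t i:]) * dP t i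
          - (smult b (P t (i - 1)) + smult (\<beta> t i) (dP t (i - 1)))) t"
      unfolding a_def b_def
      by (intro has_pL_diff has_pL_mult has_pL_smult has_pL_const has_pL_scalar
          has_L_\<alpha>[OF t] has_L_\<beta>[OF t] i)
    moreover have "([:0, 1:] - [:\<alpha> t i:]) * P t i - smult (\<beta> t i) (P t (i - 1)) = P t n" for t
      by (simp add: P_Suc Suc)
    moreover have "(0 - [:a:]) * P t i + ([:0, 1:] - [:\<alpha> t i:]) * dP t i
          - (smult b (P t (i - 1)) + smult (\<beta> t i) (dP t (i - 1))) = dP t n"
    proof -
      \<comment> \<open>Differentiating the recurrence produces
        \<open>x P\<^sub>i\<^sub>-\<^sub>1\<close>, which the recurrence at \<open>i - 1\<close>
        removes; the factor \<open>\<beta> t i\<close> covers \<open>i = 0\<close>.\<close>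
      have "smult (2 * \<beta> t i) ([:0, 1:] * P t (i - 1)) = smult (2 * \<beta> t i)
          (P t i + smult (\<alpha> t (i - 1)) (P t (i - 1)) + smult (\<beta> t (i - 1)) (P t (i - 1 - 1)))"
        unfolding X_mult_P[of t "i - 1"] by (cases i) simp_all
      then have "poly (smult (2 * \<beta> t i) ([:0, 1:] * P t (i - 1))) x = poly (smult (2 * \<beta> t i)
          (P t i + smult (\<alpha> t (i - 1)) (P t (i - 1)) + smult (\<beta> t (i - 1)) (P t (i - 1 - 1)))) x" for x
        by (rule arg_cong)
      then have X: "2 * \<beta> t i * (x * poly (P t (i - 1)) x) =
         2 * \<beta> t i * (poly (P t i) x + \<alpha> t (i - 1) * poly (P t (i - 1)) x + \<beta> t (i - 1) * poly (P t (i - 1 - 1)) x)" for x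
        by simp
      show ?thesis
      proof (rule poly_eq_poly_eq_iff[THEN iffD1], rule ext)
        fix x
        show "poly ((0 - [:a:]) * P t i + ([:0, 1:] - [:\<alpha> t i:]) * dP t i
          - (smult b (P t (i - 1)) + smult (\<beta> t i) (dP t (i - 1)))) x = poly (dP t n) x"
          using X[of x]
          by (simp add: dP_def Suc P_Suc[of t i] pderiv_diff pderiv_mult pderiv_pCons pderiv_smult
              a_def b_def del: mult_cancel_left) algebra
      qed
    qed
    ultimately show ?thesis
      by (simp only:)
  qed
qed

subsection \<open>The differential equation\<close>

definition u :: "nat \<Rightarrow> nat \<Rightarrow> (nat \<Rightarrow> real) \<Rightarrow> real" where
  "u k n t = poly (P t n) (t k)"

lemma u_rec: "u k (Suc n) t = (t k - \<alpha> t n) * u k n t - \<beta> t n * u k (n - 1) t"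
  by (simp add: u_def P_Suc algebra_simps)

text \<open>The \<open>pderiv\<close> term of \<open>dP\<close> cancels against the motion of the
  evaluation point.\<close>

lemma has_L_u:
  assumes "ordered m t" "1 \<le> k" "k \<le> m"
  shows "has_L m (u k n) (2 * \<beta> t n * u k (n - 1) t) t"
  using has_L_poly_eval[OF has_pL_P[OF assms(1)] assms(2,3), of n]
  unfolding u_def [abs_def] by (simp add: dP_def)

definition R :: "nat \<Rightarrow> nat \<Rightarrow> (nat \<Rightarrow> real) \<Rightarrow> real" where
  "R n k t = \<omega> k * exp (- (t k)\<^sup>2) * (u k n t * u k n t) / h t n"

text \<open>For \<open>n \<ge> 1\<close> and ordered \<open>t\<close>,
  \<open>\<beta> t n / h t n\<close> is the reciprocal of \<open>h t (n - 1)\<close>; in this form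
  the rules for \<open>\<beta>\<close> and \<open>h\<close> apply directly.\<close>

definition r :: "nat \<Rightarrow> nat \<Rightarrow> (nat \<Rightarrow> real) \<Rightarrow> real" where
  "r n k t = \<omega> k * exp (- (t k)\<^sup>2) * (u k n t * u k (n - 1) t) * \<beta> t n / h t n"

lemma Rnk_eq_R: "ordered m t \<Longrightarrow> Rnk m \<omega> n k t = R n k t"
  by (simp add: Rnk_def R_def u_def orth_poly_eq_P hnorm_eq_h power2_eq_square)

lemma has_L_exp_square:
  assumes "1 \<le> k" "k \<le> m"
  shows "has_L m (\<lambda>t. \<omega> k * exp (- (t k)\<^sup>2)) (- 2 * t k * (\<omega> k * exp (- (t k)\<^sup>2))) t"
  using assms by (intro has_L_coord[of _ _ "\<lambda>x. \<omega> k * exp (- x\<^sup>2)"]) (auto intro!: derivative_eq_intros)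

lemma has_L_R:
  assumes t: "ordered m t" and k: "1 \<le> k" "k \<le> m"
  shows "has_L m (R n k) ((2 * \<alpha> t n - 2 * t k) * R n k t + 4 * r n k t) t"
proof -
  let ?w = "\<omega> k * exp (- (t k)\<^sup>2)"
  have h: "h t n \<noteq> 0" using h_pos[OF t, of n] by simp
  note has_L_h[OF t has_pL_P[OF t]]
  then have "has_L m (R n k)
     (((- 2 * t k * ?w) * (u k n t * u k n t) +
       ?w * ((2 * \<beta> t n * u k (n - 1) t) * u k n t + u k n t * (2 * \<beta> t n * u k (n - 1) t))
        - ?w * (u k n t * u k n t) / h t n * (- 2 * \<alpha> t n * h t n)) / h t n) t"
    unfolding R_def [abs_def]
    by (intro has_L_divide has_L_mult has_L_exp_square has_L_u t k h)
  also have "((- 2 * t k * ?w) * (u k n t * u k n t) +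
       ?w * ((2 * \<beta> t n * u k (n - 1) t) * u k n t + u k n t * (2 * \<beta> t n * u k (n - 1) t))
        - ?w * (u k n t * u k n t) / h t n * (- 2 * \<alpha> t n * h t n)) / h t n
      = (2 * \<alpha> t n - 2 * t k) * R n k t + 4 * r n k t"
    using h by (simp add: R_def r_def field_simps)
  finally show ?thesis .
qed

text \<open>Multiplying the derivative by \<open>R\<close> expresses it through \<open>r\<close> and
  \<open>R\<close> without dividing by \<open>R\<close>, which may vanish.\<close>

lemma has_L_r:
  assumes t: "ordered m t" and k: "1 \<le> k" "k \<le> m" and n: "n \<ge> 1"
  shows "\<exists>d. has_L m (r n k) d t \<and> R n k t * d = 2 * (r n k t)\<^sup>2 - 2 * \<beta> t n * (R n k t)\<^sup>2"
proof -
  let ?w = "\<omega> k * exp (- (t k)\<^sup>2)"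
  have h: "h t n \<noteq> 0" using h_pos[OF t, of n] by simp
  obtain i where i: "n = Suc i" using n by (cases n) auto
  note has_L_h[OF t has_pL_P[OF t]] has_L_\<beta>[OF t has_pL_P[OF t] has_pL_P[OF t]]
  then have "has_L m (r n k)
     ((((- 2 * t k * ?w) * (u k n t * u k (n - 1) t) +
       ?w * ((2 * \<beta> t n * u k (n - 1) t) * u k (n - 1) t
         + u k n t * (2 * \<beta> t (n - 1) * u k (n - 1 - 1) t))) * \<beta> t n
       + ?w * (u k n t * u k (n - 1) t) * (2 * \<beta> t n * (\<alpha> t (n - 1) - \<alpha> t n))
       - ?w * (u k n t * u k (n - 1) t) * \<beta> t n / h t n * (- 2 * \<alpha> t n * h t n)) / h t n) t"
    (is "has_L _ _ ?d _")
    unfolding r_def [abs_def]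
    by (intro has_L_divide has_L_mult has_L_exp_square has_L_u t k h)
  \<comment> \<open>The recurrence at \<open>n - 1\<close> removes
    \<open>P\<^sub>n\<^sub>-\<^sub>2\<close>; afterwards all terms with \<open>t k\<close>,
    \<open>\<alpha> t (n - 1)\<close> and \<open>\<alpha> t n\<close> cancel.\<close>
  moreover have "2 * \<beta> t (n - 1) * u k (n - 1 - 1) t
      = 2 * ((t k - \<alpha> t (n - 1)) * u k (n - 1) t - u k n t)"
    using u_rec[of k "n - 1" t] i by simp
  then have "?d = 2 * ?w * \<beta> t n * (\<beta> t n * (u k (n - 1) t)\<^sup>2 - (u k n t)\<^sup>2) / h t n"
    using h by (simp only:) (simp add: field_simps power2_eq_square)
  then have "R n k t * ?d = 2 * (r n k t)\<^sup>2 - 2 * \<beta> t n * (R n k t)\<^sup>2"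
    by (simp only: R_def r_def) (use h in \<open>simp add: field_simps power2_eq_square\<close>)
  ultimately show ?thesis by blast
qed

text \<open>Two evaluations of one moment: the boundary terms at the jumps give the
  \<open>R n j t\<close>, while orthogonality removes \<open>P\<^sub>n P\<^sub>n'\<close> and leaves
  \<open>- 2 x P\<^sub>n\<^sup>2\<close>.\<close>

lemma sum_R:
  assumes t: "ordered m t"
  shows "(\<Sum>j=1..m. R n j t) = 2 * \<alpha> t n"
proof -
  have h: "h t n \<noteq> 0" using h_pos[OF t, of n] by simp
  have dP: "degree (pderiv (P t n)) \<le> n" "coeff (pderiv (P t n)) n = 0"
    by (simp_all add: degree_pderiv coeff_pderiv coeff_eq_0)
  have "gauss_deriv (P t n * P t n) = P t n * pderiv (P t n) + P t n * pderiv (P t n) - smult 2 ([:0, 1:] * P t n * P t n)"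
    by (simp add: gauss_deriv_def pderiv_mult algebra_simps flip: smult_add_left)
  then have "E t (gauss_deriv (P t n * P t n)) = - 2 * \<alpha> t n * h t n"
    by (simp only: moment_add moment_diff moment_smult E_P_mult[OF t dP(1)] dP(2) E_X_P_P[OF t])
  then have "(\<Sum>j=1..m. \<omega> j * gauss (P t n * P t n) (t j)) = 2 * \<alpha> t n * h t n"
    unfolding moment_gauss_deriv by simp
  moreover have "(\<Sum>j=1..m. R n j t) = (\<Sum>j=1..m. \<omega> j * gauss (P t n * P t n) (t j)) / h t n"
    unfolding sum_divide_distrib by (intro sum.cong) (simp_all add: R_def u_def gauss_def)
  ultimately show ?thesis
    using h by simp
qed

text \<open>The same comparison for \<open>x P\<^sub>n\<^sup>2\<close>. Since
  \<open>x P\<^sub>n'\<close> has coefficient \<open>n\<close> in degree \<open>n\<close>, it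
  contributes \<open>2 n\<close>; the derivative of \<open>x\<close> contributes 1.\<close>

lemma sum_t_R:
  assumes t: "ordered m t"
  shows "(\<Sum>j=1..m. t j * R n j t) = 2 * (\<beta> t (Suc n) + (\<alpha> t n)\<^sup>2 + \<beta> t n) - 2 * real n - 1"
proof -
  have h: "h t n \<noteq> 0" using h_pos[OF t, of n] by simp
  let ?Q = "[:0, 1:] * P t n * P t n" and ?D = "[:0, 1:] * pderiv (P t n)"
  have D: "degree ?D \<le> n" "coeff ?D n = real n"
  proof -
    show "degree ?D \<le> n"
      using degree_mult_le[of "[:0, 1:]" "pderiv (P t n)"]
      by (cases "n = 0") (auto simp: degree_pderiv pderiv_eq_0_iff)
    show "coeff ?D n = real n"
      by (cases n) (auto simp: coeff_pderiv pderiv_eq_0_iff)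
  qed
  have "gauss_deriv ?Q = P t n * P t n + P t n * ?D + P t n * ?D - smult 2 ([:0, 1:] * P t n * ([:0, 1:] * P t n))"
    by (simp add: gauss_deriv_def pderiv_mult pderiv_pCons algebra_simps flip: smult_add_left)
  then have "E t (gauss_deriv ?Q) = h t n * (1 + 2 * real n - 2 * (\<beta> t (Suc n) + (\<alpha> t n)\<^sup>2 + \<beta> t n))"
    by (simp only: moment_add moment_diff moment_smult E_P_mult[OF t D(1)] D(2) E_X_P_X_P[OF t])
       (simp add: h_def algebra_simps)
  then have "(\<Sum>j=1..m. \<omega> j * gauss ?Q (t j)) =
      h t n * (2 * (\<beta> t (Suc n) + (\<alpha> t n)\<^sup>2 + \<beta> t n) - 2 * real n - 1)"
    unfolding moment_gauss_deriv by (simp add: algebra_simps)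
  moreover have "(\<Sum>j=1..m. t j * R n j t) = (\<Sum>j=1..m. \<omega> j * gauss ?Q (t j)) / h t n"
    unfolding sum_divide_distrib by (intro sum.cong) (simp_all add: R_def u_def gauss_def)
  ultimately show ?thesis
    using h by simp
qed

section \<open>The second-order equation for \<open>Rnk\<close>\<close>

lemma has_L_Rnk:
  assumes "ordered m t" "1 \<le> k" "k \<le> m"
  shows "has_L m (Rnk m \<omega> n k) ((2 * \<alpha> t n - 2 * t k) * Rnk m \<omega> n k t + 4 * r n k t) t"
  using has_L_transfer[OF has_L_R[OF assms] assms(1) Rnk_eq_R[symmetric]]
  by (simp only: Rnk_eq_R[OF assms(1)])

lemma Rnk_second_order:
  assumes t: "ordered m t" and k: "1 \<le> k" "k \<le> m" and n: "n \<ge> 1" and nz: "Rnk m \<omega> n k t \<noteq> 0"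
  shows "Lop m (Lop m (Rnk m \<omega> n k)) t - (Lop m (Rnk m \<omega> n k) t)\<^sup>2 / (2 * Rnk m \<omega> n k t)
         = Rnk m \<omega> n k t *
           (3 / 2 * (\<Sum>j=1..m. Rnk m \<omega> n j t)\<^sup>2 - 2 * (\<Sum>j=1..m. (t k + t j) * Rnk m \<omega> n j t)
            + 2 * ((t k)\<^sup>2 - 2 * real n - 1))"
proof -
  let ?F = "\<lambda>t. (2 * \<alpha> t n - 2 * t k) * Rnk m \<omega> n k t + 4 * r n k t"
  let ?A' = "1 + 2 * \<beta> t n - 2 * \<beta> t (Suc n)"
  obtain d where d: "has_L m (r n k) d t" "Rnk m \<omega> n k t * d = 2 * (r n k t)\<^sup>2 - 2 * \<beta> t n * (Rnk m \<omega> n k t)\<^sup>2"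
    using has_L_r[OF t k n] Rnk_eq_R[OF t] by auto
  \<comment> \<open>The first-order formula is established at all ordered tuples, not only at the
    given one, so that \<open>Lop\<close> can be applied once more.\<close>
  have L: "Lop m (Rnk m \<omega> n k) t = ?F t" if "ordered m t" for t
    by (rule has_L_imp_Lop[OF has_L_Rnk[OF that k]])
  have "has_L m ?F ((((0 * \<alpha> t n + 2 * ?A') - (0 * t k + 2 * 1)) * Rnk m \<omega> n k t
      + (2 * \<alpha> t n - 2 * t k) * ?F t) + (0 * r n k t + 4 * d)) t"
    by (intro has_L_add has_L_mult has_L_diff has_L_const has_L_\<alpha>[OF t has_pL_P[OF t]]
        has_L_coord[OF k, of "\<lambda>x. x"] has_L_Rnk[OF t k] d(1)) auto
  then have "has_L m (Lop m (Rnk m \<omega> n k)) ((((0 * \<alpha> t n + 2 * ?A') - (0 * t k + 2 * 1)) * Rnk m \<omega> n k t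
      + (2 * \<alpha> t n - 2 * t k) * ?F t) + (0 * r n k t + 4 * d)) t"
    by (rule has_L_transfer[OF _ t L[symmetric]])
  then have L2: "Lop m (Lop m (Rnk m \<omega> n k)) t =
      (2 * ?A' - 2) * Rnk m \<omega> n k t + (2 * \<alpha> t n - 2 * t k) * ?F t + 4 * d"
    by (subst has_L_imp_Lop) auto
  have sums: "(\<Sum>j=1..m. Rnk m \<omega> n j t) = 2 * \<alpha> t n"
    "(\<Sum>j=1..m. t j * Rnk m \<omega> n j t) = 2 * (\<beta> t (Suc n) + (\<alpha> t n)\<^sup>2 + \<beta> t n) - 2 * real n - 1"
    unfolding Rnk_eq_R[OF t] by (rule sum_R[OF t], rule sum_t_R[OF t])
  have S: "(\<Sum>j=1..m. (t k + t j) * Rnk m \<omega> n j t) =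
      t k * (2 * \<alpha> t n) + (2 * (\<beta> t (Suc n) + (\<alpha> t n)\<^sup>2 + \<beta> t n) - 2 * real n - 1)"
    unfolding distrib_right sum.distrib sum_distrib_left[symmetric] sums ..
  define \<rho> where "\<rho> = Rnk m \<omega> n k t"
  \<comment> \<open>The factor \<open>2 * \<rho>\<close> clears the denominator and lets
    \<open>d\<close> enter only through \<open>\<rho> * d\<close>, which \<open>d(2)\<close>
    evaluates.\<close>
  have "2 * \<rho> * ((2 * ?A' - 2) * \<rho> + (2 * \<alpha> t n - 2 * t k) * ((2 * \<alpha> t n - 2 * t k) * \<rho> + 4 * r n k t) + 4 * d)
      - ((2 * \<alpha> t n - 2 * t k) * \<rho> + 4 * r n k t)\<^sup>2
      = 2 * \<rho> * (\<rho> * (3 / 2 * (2 * \<alpha> t n)\<^sup>2 - 2 * (t k * (2 * \<alpha> t n)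
         + (2 * (\<beta> t (Suc n) + (\<alpha> t n)\<^sup>2 + \<beta> t n) - 2 * real n - 1))
          + 2 * ((t k)\<^sup>2 - 2 * real n - 1)))"
    using d(2)[folded \<rho>_def] by algebra
  then show ?thesis
    unfolding S sums L2 L[OF t] using nz
    unfolding \<rho>_def[symmetric] by (simp add: field_simps)
qed

end

lemma wgt_nonzero_imp_partial_sum_nonzero:
  assumes "ordered m t" "wgt m \<omega> t x \<noteq> 0"
  shows "\<exists>l\<le>m. (\<Sum>k=0..l. \<omega> k) \<noteq> 0"
proof -
  obtain l where "l \<le> m" "\<And>k. k \<in> {1..m} \<Longrightarrow> t k < x \<longleftrightarrow> k \<le> l"
    using ordered_step_index[OF assms(1)] by blast
  then show ?thesis
    using wgt_eq_partial_sum[of l m t x \<omega>] assms(2) by auto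
qed

theorem theorem3p6:
  fixes m n k :: nat and t \<omega> :: "nat \<Rightarrow> real"
  assumes "m \<ge> 1"
    and "\<And>i j. 1 \<le> i \<Longrightarrow> i < j \<Longrightarrow> j \<le> m \<Longrightarrow> t i < t j"
    and "\<And>l. l \<le> m \<Longrightarrow> (\<Sum>k=0..l. \<omega> k) \<ge> 0"
    and "\<exists>x. wgt m \<omega> t x \<noteq> 0"
    and "n \<ge> 1"
    and "1 \<le> k" "k \<le> m"
    and "Rnk m \<omega> n k t \<noteq> 0"
  shows "Lop m (Lop m (Rnk m \<omega> n k)) t
           - (Lop m (Rnk m \<omega> n k) t)\<^sup>2 / (2 * Rnk m \<omega> n k t)
         = Rnk m \<omega> n k t *
           (3 / 2 * (\<Sum>j=1..m. Rnk m \<omega> n j t)\<^sup>2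
            - 2 * (\<Sum>j=1..m. (t k + t j) * Rnk m \<omega> n j t)
            + 2 * ((t k)\<^sup>2 - 2 * real n - 1))"
proof -
  have t: "ordered m t"
    using assms(2) by (auto simp: ordered_def)
  interpret jump_weight m \<omega>
    using assms(3,4) wgt_nonzero_imp_partial_sum_nonzero[OF t] by unfold_locales auto
  show ?thesis
    by (rule Rnk_second_order[OF t assms(6,7,5,8)])
qed

end
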